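(* Let $s=s(N)>0$. For each $N$, let $X=(X_1,\dots,X_N)$ and $Z=(Z_1,\dots,Z_N)$ be independent standard Gaussian vectors in $\mathbb R^N$, let $Y=X+sZ$, and let $p(N,s)=\mathbb P(r_1(X)=r_1(Y))$, where $r_1(T)$ is the rank of the first coordinate $t_1$ among the coordinates of $T=(t_1,\dots,t_N)$. Then: (i) If $s=o(1/N)$, then $p(N,s)\to1$ as $N\to\infty$. (ii) If $s=\omega(1/N)$ (i.e. $sN\to\infty$), then $p(N,s)\to0$ as $N\to\infty$.
   Context: The rank of $t_1$ in $T=(t_1,\dots,t_p)$ is its position when the coordinates are sorted in decreasing order (coordinates are almost surely pairwise distinct here). *)

theory Defs
  imports "HOL-Probability.Probability" "HOL-Library.Landau_Symbols"
begin

(* Vectors in R^N are functions nat => real, of which only the coordinates 1, ..., N matter. *)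

definition sorted_decreasing :: "nat \<Rightarrow> (nat \<Rightarrow> real) \<Rightarrow> real list" where
  "sorted_decreasing N t = rev (sort (map t [1..<Suc N]))"

(* Positions are counted from 1, so that the largest coordinate has rank 1.  In case of ties
   (a null event for Gaussian vectors) the first matching position is taken. *)
definition rank_first :: "nat \<Rightarrow> (nat \<Rightarrow> real) \<Rightarrow> nat" where
  "rank_first N t = (LEAST k. 1 \<le> k \<and> k \<le> N \<and> sorted_decreasing N t ! (k - 1) = t 1)"

definition std_gaussian_vector :: "'a measure \<Rightarrow> nat \<Rightarrow> ('a \<Rightarrow> nat \<Rightarrow> real) \<Rightarrow> bool" where
  "std_gaussian_vector M N X \<longleftrightarrow>
     prob_space.indep_vars M (\<lambda>_. borel) (\<lambda>i \<omega>. X \<omega> i) {1..N} \<and>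
     (\<forall>i\<in>{1..N}. distributed M lborel (\<lambda>\<omega>. X \<omega> i) std_normal_density)"

(* Elements of the product space PiM {1..N} are undefined outside {1..N}, hence the restriction. *)
definition indep_vectors ::
    "'a measure \<Rightarrow> nat \<Rightarrow> ('a \<Rightarrow> nat \<Rightarrow> real) \<Rightarrow> ('a \<Rightarrow> nat \<Rightarrow> real) \<Rightarrow> bool" where
  "indep_vectors M N X Z \<longleftrightarrow>
     prob_space.indep_var M
       (PiM {1..N} (\<lambda>_. borel)) (\<lambda>\<omega>. restrict (X \<omega>) {1..N})
       (PiM {1..N} (\<lambda>_. borel)) (\<lambda>\<omega>. restrict (Z \<omega>) {1..N})"

definition prob_same_rank ::
    "'a measure \<Rightarrow> nat \<Rightarrow> ('a \<Rightarrow> nat \<Rightarrow> real) \<Rightarrow> ('a \<Rightarrow> nat \<Rightarrow> real) \<Rightarrow> real" where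
  "prob_same_rank M N X Y = measure M {\<omega> \<in> space M. rank_first N (X \<omega>) = rank_first N (Y \<omega>)}"

end

theory Submission
  imports Defs
begin

text \<open>
  The rank of the first coordinate is one plus the number of coordinates exceeding it, so it is
  unchanged iff the signed count of the coordinates \<open>j \<ge> 2\<close> that cross the first one is zero.  Given
  \<open>(X\<^sub>1, Z\<^sub>1)\<close> the crossings are i.i.d. with values in \<open>{-1, 0, 1}\<close>.
  A coordinate crosses only if \<open>X\<^sub>j\<close> lies in an interval of length \<open>s \<bar>Z\<^sub>1 - Z\<^sub>j\<bar>\<close>, which has
  probability \<open>O(s)\<close>; the union bound gives (i).
  For (ii), the probability that an integer-valued sum \<open>S\<close> vanishes is at most the mean of its
  characteristic function over the \<open>m\<close>-th roots of unity.  Given \<open>(X\<^sub>1, Z\<^sub>1)\<close>, the values \<open>1\<close> and \<open>0\<close>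
  both have probability at least a positive multiple of \<open>min 1 s\<close>, so the characteristic function
  of one crossing has modulus at most \<open>1 - c min 1 s\<close> away from the root \<open>1\<close>.  Its \<open>(N - 1)\<close>-st power
  tends to \<open>0\<close> because \<open>s N \<rightarrow> \<infinity>\<close>, and dominated convergence leaves only the term \<open>1 / m\<close> of the
  trivial root.
\<close>

section \<open>Ranks as counts of larger coordinates\<close>

lemma sorted_eq_filter_append:
  fixes xs :: "'a::linorder list"
  assumes "sorted xs"
  shows "xs = filter (\<lambda>x. x \<le> a) xs @ filter (\<lambda>x. a < x) xs"
  using assms
proof (induction xs)
  case Nil
  then show ?case by simp
next
  case (Cons y ys)
  show ?case
  proof (cases "y \<le> a")
    case True
    then show ?thesis using Cons by auto
  next
    case False
    then have "filter (\<lambda>x. x \<le> a) ys = []" "filter (\<lambda>x. a < x) ys = ys"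
      using Cons.prems by (fastforce simp: filter_empty_conv filter_id_conv)+
    then show ?thesis using False by simp
  qed
qed

text \<open>The entries above \<open>t 1\<close> fill a prefix of the decreasing list, and a copy of
  \<open>t 1\<close> follows directly. \<open>LEAST\<close> selects exactly this copy, so no null
  set of ties has to be removed.\<close>

lemma rank_first_eq_Suc_card:
  assumes "1 \<le> N"
  shows "rank_first N t = Suc (card {j\<in>{1..N}. t 1 < t j})"
proof -
  define ys where "ys = map t [1..<Suc N]"
  define a where "a = t 1"
  define lo where "lo = filter (\<lambda>x. x \<le> a) (sort ys)"
  define hi where "hi = filter (\<lambda>x. a < x) (sort ys)"
  have split: "sorted_decreasing N t = rev hi @ rev lo"
    using sorted_eq_filter_append[of "sort ys" a]
    by (metis hi_def lo_def rev_append sorted_decreasing_def sorted_sort ys_def)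
  have "a \<in> set ys"
    using assms by (auto simp: ys_def a_def simp del: upt_Suc)
  then have "a \<in> set lo"
    by (simp add: lo_def)
  then have lo_ne: "lo \<noteq> []"
    by auto
  have "sorted lo"
    unfolding lo_def by (rule sorted_wrt_filter) simp
  \<comment> \<open>The last entry of \<open>lo\<close> is \<open>a\<close> itself: \<open>a\<close>
    occurs in \<open>lo\<close> and nothing in \<open>lo\<close> exceeds it. After reversal it
    stands right behind \<open>rev hi\<close>.\<close>
  have "a \<le> last lo"
  proof -
    obtain i where "i < length lo" "lo ! i = a"
      using \<open>a \<in> set lo\<close> by (auto simp: in_set_conv_nth)
    then show ?thesis
      using sorted_nth_mono[OF \<open>sorted lo\<close>, of i "length lo - 1"] lo_ne by (simp add: last_conv_nth)
  qed
  moreover have "last lo \<le> a"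
    using last_in_set[OF lo_ne] by (simp add: lo_def)
  ultimately have last: "last lo = a"
    by simp
  have "length hi = length (filter (\<lambda>x. a < x) ys)"
    unfolding hi_def by (metis mset_filter mset_sort size_mset)
  also have "\<dots> = length (filter (\<lambda>j. a < t j) [1..<Suc N])"
    by (simp add: ys_def filter_map o_def)
  also have "\<dots> = card {j\<in>{1..N}. t 1 < t j}"
    by (subst distinct_card[symmetric]) (auto intro!: arg_cong[where f=card] simp: a_def)
  finally have len: "length hi = card {j\<in>{1..N}. t 1 < t j}" .
  have "length hi + length lo = N"
    using arg_cong[OF split, of length] by (simp add: sorted_decreasing_def del: upt_Suc)
  moreover have "0 < length lo"
    using lo_ne by simp
  ultimately have bound: "Suc (length hi) \<le> N"
    by linarith
  show ?thesis
    unfolding rank_first_def len[symmetric]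
  proof (rule Least_equality)
    show "1 \<le> Suc (length hi) \<and> Suc (length hi) \<le> N \<and>
        sorted_decreasing N t ! (Suc (length hi) - 1) = t 1"
      using bound lo_ne last
      by (auto simp: split nth_append rev_nth a_def last_conv_nth)
  next
    fix k assume k: "1 \<le> k \<and> k \<le> N \<and> sorted_decreasing N t ! (k - 1) = t 1"
    show "Suc (length hi) \<le> k"
    proof (rule ccontr)
      \<comment> \<open>An earlier position falls into \<open>rev hi\<close>, whose entries strictly
        exceed \<open>a\<close>.\<close>
      assume "\<not> Suc (length hi) \<le> k"
      then have "k - 1 < length hi"
        using k by linarith
      then have "sorted_decreasing N t ! (k - 1) \<in> set hi"
        using k nth_mem[of "k - 1" "rev hi"] by (auto simp: split nth_append)
      then show False
        using k by (simp add: hi_def a_def)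
    qed
  qed
qed

section \<open>Joint law of the pairs (X_i, Z_i)\<close>

text \<open>The probability of a rectangle factors twice: between the two vectors by
  \<open>XZ\<close>, then over the coordinates of each by \<open>X\<close> and \<open>Z\<close>.
  Hence all the variables together are independent, and grouping them by index keeps this.\<close>

lemma (in prob_space) indep_vars_Pair:
  assumes I: "I \<noteq> {}" "finite I"
    and X: "indep_vars S X I" and Z: "indep_vars T Z I"
    and XZ: "indep_var (PiM I S) (\<lambda>\<omega>. \<lambda>i\<in>I. X i \<omega>) (PiM I T) (\<lambda>\<omega>. \<lambda>i\<in>I. Z i \<omega>)"
  shows "indep_vars (\<lambda>i. S i \<Otimes>\<^sub>M T i) (\<lambda>i \<omega>. (X i \<omega>, Z i \<omega>)) I"
proof -
  \<comment> \<open>One family over \<open>I \<times> UNIV\<close>: the Boolean selects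
    \<open>X i\<close> (\<open>True\<close>) or \<open>Z i\<close> (\<open>False\<close>).\<close>
  define U where "U = (\<lambda>(i, b). if b then X i else Z i)"
  define R where "R = (\<lambda>(i, b). if b then S i else T i)"
  have rv: "random_variable (S i) (X i)" "random_variable (T i) (Z i)" if "i \<in> I" for i
    using X Z that by (auto simp: indep_vars_def)
  have "indep_vars R U (I \<times> UNIV)"
  proof (subst indep_vars_finite[where E="\<lambda>i. sets (R i)"])
    show "\<forall>A\<in>Pi (I \<times> UNIV) (\<lambda>i. sets (R i)).
       prob (\<Inter>j\<in>I \<times> UNIV. U j -` A j \<inter> space M) = (\<Prod>j\<in>I \<times> UNIV. prob (U j -` A j \<inter> space M))"
    proof
      fix A assume A: "A \<in> Pi (I \<times> UNIV) (\<lambda>i. sets (R i))"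
      have AT: "A (i, True) \<in> sets (S i)" and AF: "A (i, False) \<in> sets (T i)" if "i \<in> I" for i
        using Pi_mem[OF A, of "(i, True)"] Pi_mem[OF A, of "(i, False)"] that by (auto simp: R_def)
      define B where "B = Pi\<^sub>E I (\<lambda>i. A (i, True))"
      define C where "C = Pi\<^sub>E I (\<lambda>i. A (i, False))"
      have "(\<Inter>j\<in>I \<times> UNIV. U j -` A j \<inter> space M) =
          (\<lambda>\<omega>. (\<lambda>i\<in>I. X i \<omega>, \<lambda>i\<in>I. Z i \<omega>)) -` (B \<times> C) \<inter> space M"
        using I by (auto simp: U_def B_def C_def PiE_iff UNIV_bool split: if_splits)
      then have "prob (\<Inter>j\<in>I \<times> UNIV. U j -` A j \<inter> space M) =
          prob ((\<lambda>\<omega>. \<lambda>i\<in>I. X i \<omega>) -` B \<inter> space M) * prob ((\<lambda>\<omega>. \<lambda>i\<in>I. Z i \<omega>) -` C \<inter> space M)"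
        using I AT AF by (simp add: B_def C_def indep_varD[OF XZ] sets_PiM_I_finite)
      also have "(\<lambda>\<omega>. \<lambda>i\<in>I. X i \<omega>) -` B \<inter> space M = (\<Inter>i\<in>I. X i -` A (i, True) \<inter> space M)"
        using I by (auto simp: B_def PiE_iff)
      also have "prob \<dots> = (\<Prod>i\<in>I. prob (X i -` A (i, True) \<inter> space M))"
        using I AT by (intro indep_varsD_finite[OF X]) auto
      also have "(\<lambda>\<omega>. \<lambda>i\<in>I. Z i \<omega>) -` C \<inter> space M = (\<Inter>i\<in>I. Z i -` A (i, False) \<inter> space M)"
        using I by (auto simp: C_def PiE_iff)
      also have "prob \<dots> = (\<Prod>i\<in>I. prob (Z i -` A (i, False) \<inter> space M))"
        using I AF by (intro indep_varsD_finite[OF Z]) auto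
      finally show "prob (\<Inter>j\<in>I \<times> UNIV. U j -` A j \<inter> space M) =
          (\<Prod>j\<in>I \<times> UNIV. prob (U j -` A j \<inter> space M))"
        unfolding prod.cartesian_product'
        by (simp add: UNIV_bool prod.distrib U_def mult.commute)
    qed
  qed (use I rv in \<open>auto simp: R_def U_def Int_stable_def sets.sigma_sets_eq split: if_split_asm dest: sets.sets_into_space\<close>)
  \<comment> \<open>The index blocks \<open>{i} \<times> UNIV\<close> are disjoint, so the
    restrictions to them are independent; each block is then read as a pair.\<close>
  then have "indep_vars (\<lambda>i. PiM ({i} \<times> UNIV) R) (\<lambda>i \<omega>. restrict (\<lambda>j. U j \<omega>) ({i} \<times> UNIV)) I"
    by (rule indep_vars_restrict) (auto simp: disjoint_family_on_def)
  then have "indep_vars (\<lambda>i. S i \<Otimes>\<^sub>M T i)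
      (\<lambda>i \<omega>. (\<lambda>r. (r (i, True), r (i, False))) (restrict (\<lambda>j. U j \<omega>) ({i} \<times> UNIV))) I"
  proof (rule indep_vars_compose2)
    fix i
    have "(\<lambda>r. r (i, True)) \<in> PiM ({i} \<times> UNIV) R \<rightarrow>\<^sub>M R (i, True)"
      "(\<lambda>r. r (i, False)) \<in> PiM ({i} \<times> UNIV) R \<rightarrow>\<^sub>M R (i, False)"
      by (rule measurable_component_singleton; simp)+
    then show "(\<lambda>r. (r (i, True), r (i, False))) \<in> PiM ({i} \<times> UNIV) R \<rightarrow>\<^sub>M S i \<Otimes>\<^sub>M T i"
      by (intro measurable_Pair) (simp_all add: R_def)
  qed
  then show ?thesis
    by (simp add: U_def)
qed

abbreviation std_normal_pair :: "(real \<times> real) measure" where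
  "std_normal_pair \<equiv> std_normal_distribution \<Otimes>\<^sub>M std_normal_distribution"

lemma prob_space_std_normal: "prob_space std_normal_distribution"
  using real_dist_normal_dist by (simp add: real_distribution_def)

lemma prob_space_std_normal_pair: "prob_space std_normal_pair"
  by (intro prob_space_pair prob_space_std_normal)

lemma sets_std_normal_pair [measurable_cong]: "sets std_normal_pair = sets (borel \<Otimes>\<^sub>M borel)"
  by (intro sets_pair_measure_cong) simp_all

lemma space_std_normal_pair [simp]: "space std_normal_pair = UNIV"
  by (simp add: space_pair_measure)

text \<open>The space \<open>M\<close> is arbitrary and may change with \<open>N\<close>; passing to
  the joint law replaces it by an explicit product measure. Independence over \<open>i\<close> makes
  the law a product of marginals, and independence of X_i and Z_i makes each marginal a
  product.\<close>

lemma distr_gaussian_pairs: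
  assumes N: "1 \<le> N" and M: "prob_space M"
    and X: "std_gaussian_vector M N X" and Z: "std_gaussian_vector M N Z"
    and XZ: "indep_vectors M N X Z"
  shows "distr M (PiM {1..N} (\<lambda>_. borel \<Otimes>\<^sub>M borel)) (\<lambda>\<omega>. \<lambda>i\<in>{1..N}. (X \<omega> i, Z \<omega> i)) =
    PiM {1..N} (\<lambda>_. std_normal_pair)"
proof -
  interpret prob_space M by fact
  let ?I = "{1..N}"
  have iX: "indep_vars (\<lambda>_. borel) (\<lambda>i \<omega>. X \<omega> i) ?I" and iZ: "indep_vars (\<lambda>_. borel) (\<lambda>i \<omega>. Z \<omega> i) ?I"
    and dX: "\<And>i. i \<in> ?I \<Longrightarrow> distributed M lborel (\<lambda>\<omega>. X \<omega> i) std_normal_density"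
    and dZ: "\<And>i. i \<in> ?I \<Longrightarrow> distributed M lborel (\<lambda>\<omega>. Z \<omega> i) std_normal_density"
    using X Z by (auto simp: std_gaussian_vector_def)
  have iXZ: "indep_var (PiM ?I (\<lambda>_. borel)) (\<lambda>\<omega>. \<lambda>i\<in>?I. X \<omega> i) (PiM ?I (\<lambda>_. borel)) (\<lambda>\<omega>. \<lambda>i\<in>?I. Z \<omega> i)"
    using XZ by (simp add: indep_vectors_def restrict_def)
  have ind: "indep_vars (\<lambda>_. borel \<Otimes>\<^sub>M borel) (\<lambda>i \<omega>. (X \<omega> i, Z \<omega> i)) ?I"
    using N by (intro indep_vars_Pair iX iZ iXZ) auto
  have marg: "distr M (borel \<Otimes>\<^sub>M borel) (\<lambda>\<omega>. (X \<omega> i, Z \<omega> i)) = std_normal_pair" if i: "i \<in> ?I" for i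
  proof -
    have comp: "(\<lambda>f. f i) \<in> PiM ?I (\<lambda>_. borel) \<rightarrow>\<^sub>M (borel :: real measure)"
      using i by simp
    \<comment> \<open>Projecting both independent vectors to coordinate \<open>i\<close> preserves
      independence.\<close>
    have "indep_var borel ((\<lambda>f. f i) \<circ> (\<lambda>\<omega>. \<lambda>i\<in>?I. X \<omega> i)) borel ((\<lambda>f. f i) \<circ> (\<lambda>\<omega>. \<lambda>i\<in>?I. Z \<omega> i))"
      by (rule indep_var_compose[OF iXZ comp comp])
    then have "indep_var borel (\<lambda>\<omega>. X \<omega> i) borel (\<lambda>\<omega>. Z \<omega> i)"
      using i by (simp add: o_def)
    then have "distr M borel (\<lambda>\<omega>. X \<omega> i) \<Otimes>\<^sub>M distr M borel (\<lambda>\<omega>. Z \<omega> i) =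
        distr M (borel \<Otimes>\<^sub>M borel) (\<lambda>\<omega>. (X \<omega> i, Z \<omega> i))"
      by (simp add: indep_var_distribution_eq)
    moreover have "distr M borel (\<lambda>\<omega>. X \<omega> i) = std_normal_distribution"
      "distr M borel (\<lambda>\<omega>. Z \<omega> i) = std_normal_distribution"
      using distributed_distr_eq_density[OF dX[OF i]] distributed_distr_eq_density[OF dZ[OF i]]
      by (simp_all cong: distr_cong)
    ultimately show ?thesis
      by simp
  qed
  have "distr M (PiM ?I (\<lambda>_. borel \<Otimes>\<^sub>M borel)) (\<lambda>\<omega>. \<lambda>i\<in>?I. (X \<omega> i, Z \<omega> i)) =
      PiM ?I (\<lambda>i. distr M (borel \<Otimes>\<^sub>M borel) (\<lambda>\<omega>. (X \<omega> i, Z \<omega> i)))"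
    using N ind by (subst indep_vars_iff_distr_eq_PiM'[symmetric]) (auto simp: indep_vars_def)
  also have "\<dots> = PiM ?I (\<lambda>_. std_normal_pair)"
    by (intro PiM_cong marg) auto
  finally show ?thesis .
qed

section \<open>Signed crossings and the reduction to a product measure\<close>

text \<open>The arguments are the pairs (X_1, Z_1) and (X_j, Z_j). The sign records the direction of
  the crossing, so that the sum over j is the rank in X minus the rank in Y.\<close>

definition swap :: "real \<Rightarrow> real \<times> real \<Rightarrow> real \<times> real \<Rightarrow> real" where
  "swap s a b = of_bool (fst a < fst b) - of_bool (fst a + s * snd a < fst b + s * snd b)"

lemma measurable_swap [measurable]:
  "case_prod (swap s) \<in> borel_measurable ((borel \<Otimes>\<^sub>M borel) \<Otimes>\<^sub>M (borel \<Otimes>\<^sub>M borel))"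
  unfolding swap_def of_bool_def by measurable

lemma rank_first_eq_iff_sum_swap:
  assumes "1 \<le> N"
  shows "rank_first N x = rank_first N (\<lambda>i. x i + s * z i) \<longleftrightarrow>
    (\<Sum>j\<in>{2..N}. swap s (x 1, z 1) (x j, z j)) = 0"
proof -
  have card: "real (card {j\<in>{1..N}. t 1 < t j}) = (\<Sum>j\<in>{1..N}. of_bool (t 1 < t j))"
    for t :: "nat \<Rightarrow> real"
    by (subst sum_of_bool_eq) (auto intro!: arg_cong[where f=card])
  \<comment> \<open>The index 1 may be added to the sum: there \<open>swap\<close> compares a pair
    with itself and is 0.\<close>
  have "{1..N} = insert 1 {2..N}"
    using assms by auto
  then have "(\<Sum>j\<in>{2..N}. swap s (x 1, z 1) (x j, z j)) = (\<Sum>j\<in>{1..N}. swap s (x 1, z 1) (x j, z j))"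
    by (simp add: swap_def)
  also have "\<dots> = real (card {j\<in>{1..N}. x 1 < x j}) - real (card {j\<in>{1..N}. x 1 + s * z 1 < x j + s * z j})"
    unfolding card[of x] card[of "\<lambda>i. x i + s * z i"] by (simp add: swap_def sum_subtractf)
  finally show ?thesis
    using rank_first_eq_Suc_card[OF assms, of x]
      rank_first_eq_Suc_card[OF assms, of "\<lambda>i. x i + s * z i"] by simp
qed

text \<open>
  The pairs \<open>(X\<^sub>j, Z\<^sub>j)\<close>, with the first one split off so that it can be conditioned on by Fubini.
\<close>

abbreviation pairs_space :: "nat \<Rightarrow> ((real \<times> real) \<times> (nat \<Rightarrow> real \<times> real)) measure" where
  "pairs_space N \<equiv> std_normal_pair \<Otimes>\<^sub>M PiM {2..N} (\<lambda>_. std_normal_pair)"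

lemma prob_space_PiM_std_normal_pair: "prob_space (PiM I (\<lambda>_. std_normal_pair))"
  by (intro prob_space_PiM prob_space_std_normal_pair)

lemma prob_space_pairs_space: "prob_space (pairs_space N)"
  by (intro prob_space_pair prob_space_std_normal_pair prob_space_PiM_std_normal_pair)

definition sum_swap :: "nat \<Rightarrow> real \<Rightarrow> (real \<times> real) \<times> (nat \<Rightarrow> real \<times> real) \<Rightarrow> real" where
  "sum_swap N s w = (\<Sum>j\<in>{2..N}. swap s (fst w) (snd w j))"

lemma measurable_swap_component [measurable]:
  assumes "j \<in> {2..N}"
  shows "(\<lambda>w. swap s (fst w) (snd w j)) \<in> borel_measurable (pairs_space N)"
proof -
  have c: "(\<lambda>w. (fst w, snd w j)) \<in> pairs_space N \<rightarrow>\<^sub>M std_normal_pair \<Otimes>\<^sub>M std_normal_pair"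
    using assms by measurable
  have "case_prod (swap s) \<in> borel_measurable (std_normal_pair \<Otimes>\<^sub>M std_normal_pair)"
    by measurable
  from measurable_compose[OF c this] show ?thesis
        by simp
qed

lemma measurable_sum_swap [measurable]: "sum_swap N s \<in> borel_measurable (pairs_space N)"
  unfolding sum_swap_def[abs_def] by (intro borel_measurable_sum measurable_swap_component)

text \<open>The event depends on the outcome only through the pairs. Their law moves it to
  \<open>?Q\<close>, and the map \<open>?h\<close>, which reinserts the first pair, moves it on to
  \<open>pairs_space N\<close>.\<close>

lemma prob_same_rank_eq:
  assumes N: "1 \<le> N" and M: "prob_space M"
    and X: "std_gaussian_vector M N X" and Z: "std_gaussian_vector M N Z"
    and XZ: "indep_vectors M N X Z"
  shows "prob_same_rank M N X (\<lambda>\<omega> i. X \<omega> i + s * Z \<omega> i) =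
    measure (pairs_space N) {w \<in> space (pairs_space N). sum_swap N s w = 0}"
proof -
  interpret prob_space M by fact
  let ?Q = "PiM {1..N} (\<lambda>_. std_normal_pair)"
  let ?V = "\<lambda>\<omega>. \<lambda>i\<in>{1..N}. (X \<omega> i, Z \<omega> i)"
  let ?h = "\<lambda>(a, r). r(1 := a)"
  define E where "E = {v \<in> space ?Q. (\<Sum>j\<in>{2..N}. swap s (v 1) (v j)) = 0}"
  have mV: "?V \<in> M \<rightarrow>\<^sub>M ?Q"
  proof (rule measurable_restrict)
    fix i assume "i \<in> {1..N}"
    then have "distributed M lborel (\<lambda>\<omega>. X \<omega> i) std_normal_density"
      "distributed M lborel (\<lambda>\<omega>. Z \<omega> i) std_normal_density"
      using X Z by (auto simp: std_gaussian_vector_def)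
    then have "(\<lambda>\<omega>. X \<omega> i) \<in> borel_measurable M" "(\<lambda>\<omega>. Z \<omega> i) \<in> borel_measurable M"
      by (auto dest: distributed_measurable)
    then show "(\<lambda>\<omega>. (X \<omega> i, Z \<omega> i)) \<in> M \<rightarrow>\<^sub>M std_normal_pair"
      by measurable
  qed
  \<comment> \<open>Of its target, \<open>distr\<close> uses only the space and the sigma-algebra,
    and these agree for \<open>?Q\<close> and the product of Borel spaces.\<close>
  have "distr M ?Q ?V = distr M (PiM {1..N} (\<lambda>_. borel \<Otimes>\<^sub>M borel)) ?V"
    by (intro distr_cong sets_PiM_cong sets_std_normal_pair refl)
  then have dV: "distr M ?Q ?V = ?Q"
    using distr_gaussian_pairs[OF assms] by (rule trans)
  have ins: "insert 1 {2..N} = {1..N}"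
    using N by auto
  have dh: "distr (pairs_space N) ?Q ?h = ?Q"
    using distr_pair_PiM_eq_PiM[of "{2..N}" "\<lambda>_. std_normal_pair" 1]
    by (simp only: ins prob_space_std_normal_pair)
  have mh: "?h \<in> pairs_space N \<rightarrow>\<^sub>M ?Q"
    unfolding ins[symmetric] by (measurable; simp)
  have E: "E \<in> sets ?Q"
  proof -
    have "(\<lambda>v. swap s (v 1) (v j)) \<in> borel_measurable ?Q" if "j \<in> {2..N}" for j
    proof -
      have c: "(\<lambda>v. (v 1, v j)) \<in> ?Q \<rightarrow>\<^sub>M std_normal_pair \<Otimes>\<^sub>M std_normal_pair"
        using that N by (intro measurable_Pair measurable_component_singleton) auto
      have "case_prod (swap s) \<in> borel_measurable (std_normal_pair \<Otimes>\<^sub>M std_normal_pair)"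
        by measurable
      from measurable_compose[OF c this] show ?thesis
        by simp
    qed
    then have "(\<lambda>v. \<Sum>j\<in>{2..N}. swap s (v 1) (v j)) \<in> borel_measurable ?Q"
      by (intro borel_measurable_sum)
    then show ?thesis
      unfolding E_def by measurable
  qed
  have "?V -` E \<inter> space M = {\<omega> \<in> space M. rank_first N (X \<omega>) = rank_first N (\<lambda>i. X \<omega> i + s * Z \<omega> i)}"
    using measurable_space[OF mV] N
    by (auto simp: E_def rank_first_eq_iff_sum_swap)
  then have "prob_same_rank M N X (\<lambda>\<omega> i. X \<omega> i + s * Z \<omega> i) = measure ?Q E"
    using measure_distr[OF mV E] by (simp only: dV prob_same_rank_def)
  also have "?h -` E \<inter> space (pairs_space N) = {w \<in> space (pairs_space N). sum_swap N s w = 0}"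
  proof -
    have "?h w \<in> E \<longleftrightarrow> sum_swap N s w = 0" if "w \<in> space (pairs_space N)" for w
    proof -
      have "(\<Sum>j\<in>{2..N}. swap s (?h w 1) (?h w j)) = sum_swap N s w"
        unfolding sum_swap_def by (intro sum.cong) (auto simp: case_prod_beta)
      then show ?thesis
        using measurable_space[OF mh that] by (simp only: E_def mem_Collect_eq simp_thms)
    qed
    then show ?thesis
      by blast
  qed
  then have "measure ?Q E = measure (pairs_space N) {w \<in> space (pairs_space N). sum_swap N s w = 0}"
    using measure_distr[OF mh E] by (simp only: dh)
  finally show ?thesis .
qed

section \<open>Gaussian measure of intervals\<close>

lemma emeasure_std_normal_le:
  assumes "l \<le> u"
  shows "emeasure std_normal_distribution {l..u} \<le> ennreal (u - l)"
proof -
  have le1: "std_normal_density x \<le> 1" for x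
  proof -
    have "1 \<le> sqrt (2 * pi)"
      using pi_gt3 by simp
    moreover have "exp (- x\<^sup>2 / 2) \<le> 1"
      by simp
    ultimately have "exp (- x\<^sup>2 / 2) \<le> sqrt (2 * pi)"
      by linarith
    then show ?thesis
      by (simp add: std_normal_density_def divide_le_eq)
  qed
  have "emeasure std_normal_distribution {l..u} =
      (\<integral>\<^sup>+x. ennreal (std_normal_density x) * indicator {l..u} x \<partial>lborel)"
    by (simp add: emeasure_density)
  also have "\<dots> \<le> (\<integral>\<^sup>+x. 1 * indicator {l..u} x \<partial>lborel)"
    using le1 by (intro nn_integral_mono mult_right_mono) auto
  also have "\<dots> = ennreal (u - l)"
    using assms by simp
  finally show ?thesis .
qed

text \<open>Because \<open>h \<le> 1\<close>, all points of the interval have modulus at most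
  \<open>\<bar>x\<bar> + 1\<close>, and the density decreases in the modulus.\<close>

lemma measure_std_normal_ge:
  assumes "0 \<le> h" "h \<le> 1"
  shows "h * std_normal_density (\<bar>x\<bar> + 1) \<le> measure std_normal_distribution {x<..x + h}"
proof -
  interpret prob_space std_normal_distribution
    by (rule prob_space_std_normal)
  have ge: "std_normal_density (\<bar>x\<bar> + 1) \<le> std_normal_density y" if "y \<in> {x<..x + h}" for y
  proof -
    have "\<bar>y\<bar> \<le> \<bar>\<bar>x\<bar> + 1\<bar>"
      using that assms by auto
    then have "y\<^sup>2 \<le> (\<bar>x\<bar> + 1)\<^sup>2"
      by (simp only: abs_le_square_iff)
    then show ?thesis
      by (simp add: std_normal_density_def divide_right_mono)
  qed
  have "ennreal (h * std_normal_density (\<bar>x\<bar> + 1)) =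
      (\<integral>\<^sup>+y. ennreal (std_normal_density (\<bar>x\<bar> + 1)) * indicator {x<..x + h} y \<partial>lborel)"
    using assms by (subst nn_integral_cmult_indicator) (auto simp: ennreal_mult' mult.commute)
  also have "\<dots> \<le> (\<integral>\<^sup>+y. ennreal (std_normal_density y) * indicator {x<..x + h} y \<partial>lborel)"
    using ge by (intro nn_integral_mono) (auto simp: indicator_def intro!: ennreal_leI)
  also have "\<dots> = emeasure std_normal_distribution {x<..x + h}"
    by (simp add: emeasure_density)
  finally show ?thesis
    by (simp add: emeasure_eq_measure)
qed

section \<open>Union bound for small noise\<close>

text \<open>With the noise \<open>v\<close> of \<open>b\<close> fixed, a crossing confines
  \<open>fst b\<close> to an interval of length \<open>s * \<bar>snd a - v\<bar>\<close>, and the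
  density is at most 1. The integral is left unevaluated so that it can be averaged over
  \<open>a\<close> later.\<close>

lemma emeasure_swap_nonzero_le:
  assumes "0 \<le> s"
  shows "emeasure std_normal_pair {b. swap s a b \<noteq> 0} \<le>
    (\<integral>\<^sup>+v. ennreal s * (ennreal \<bar>snd a\<bar> + ennreal \<bar>v\<bar>) \<partial>std_normal_distribution)"
proof -
  interpret prob_space std_normal_distribution
    by (rule prob_space_std_normal)
  interpret pair_sigma_finite std_normal_distribution std_normal_distribution ..
  have [measurable]: "swap s a \<in> borel_measurable (borel \<Otimes>\<^sub>M borel)"
    unfolding swap_def[abs_def] of_bool_def by measurable
  have "{b \<in> space std_normal_pair. swap s a b \<noteq> 0} \<in> sets std_normal_pair"
    by measurable
  then have "emeasure std_normal_pair {b. swap s a b \<noteq> 0} =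
      (\<integral>\<^sup>+v. emeasure std_normal_distribution ((\<lambda>u. (u, v)) -` {b. swap s a b \<noteq> 0}) \<partial>std_normal_distribution)"
    by (intro emeasure_pair_measure_alt2) simp
  also have "\<dots> \<le> (\<integral>\<^sup>+v. ennreal s * (ennreal \<bar>snd a\<bar> + ennreal \<bar>v\<bar>) \<partial>std_normal_distribution)"
  proof (rule nn_integral_mono)
    fix v
    \<comment> \<open>The threshold after noise: \<open>u + s * v\<close> exceeds
      \<open>fst a + s * snd a\<close> iff \<open>u\<close> exceeds \<open>y\<close>.\<close>
    define y where "y = fst a + s * (snd a - v)"
    have "(\<lambda>u. (u, v)) -` {b. swap s a b \<noteq> 0} \<subseteq> {min (fst a) y..max (fst a) y}"
      by (auto simp: swap_def y_def algebra_simps split: if_splits)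
    then have "emeasure std_normal_distribution ((\<lambda>u. (u, v)) -` {b. swap s a b \<noteq> 0}) \<le>
        emeasure std_normal_distribution {min (fst a) y..max (fst a) y}"
      by (rule emeasure_mono) simp
    also have "\<dots> \<le> ennreal (max (fst a) y - min (fst a) y)"
      by (rule emeasure_std_normal_le) simp
    also have "max (fst a) y - min (fst a) y = \<bar>s * (snd a - v)\<bar>"
      by (simp add: y_def)
    also have "\<dots> \<le> s * (\<bar>snd a\<bar> + \<bar>v\<bar>)"
      using assms by (simp add: abs_mult mult_left_mono abs_triangle_ineq4)
    finally show "emeasure std_normal_distribution ((\<lambda>u. (u, v)) -` {b. swap s a b \<noteq> 0}) \<le>
        ennreal s * (ennreal \<bar>snd a\<bar> + ennreal \<bar>v\<bar>)"
      using assms by (simp add: ennreal_mult' ennreal_plus[symmetric] ennreal_leI del: ennreal_plus)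
  qed
  finally show ?thesis .
qed

text \<open>A nonzero sum has a nonzero term. Each of the at most N terms costs at most s times the
  mean of |Z_1| + |Z_j|, which explains the factor 2.\<close>

lemma measure_sum_swap_nonzero_le:
  assumes "0 \<le> s"
  shows "measure (pairs_space N) {w \<in> space (pairs_space N). sum_swap N s w \<noteq> 0} \<le>
    2 * (\<integral>v. \<bar>v\<bar> \<partial>std_normal_distribution) * (real N * s)"
proof -
  interpret G: prob_space std_normal_distribution
    by (rule prob_space_std_normal)
  interpret P: prob_space "pairs_space N"
    by (rule prob_space_pairs_space)
  interpret R: prob_space "PiM {2..N} (\<lambda>_. std_normal_pair)"
    by (rule prob_space_PiM_std_normal_pair)
  define m where "m = (\<integral>v. \<bar>v\<bar> \<partial>std_normal_distribution)"
  have m0: "0 \<le> m"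
    unfolding m_def by simp
  have "integrable std_normal_distribution (\<lambda>x. \<bar>x\<bar>)"
    using integrable_std_normal_distribution_moment[of 1] by simp
  then have m: "(\<integral>\<^sup>+v. ennreal \<bar>v\<bar> \<partial>std_normal_distribution) = ennreal m"
    unfolding m_def by (rule nn_integral_eq_integral) simp
  define F where "F j = {w \<in> space (pairs_space N). swap s (fst w) (snd w j) \<noteq> 0}" for j
  have F [measurable]: "F j \<in> sets (pairs_space N)" if "j \<in> {2..N}" for j
    unfolding F_def using measurable_swap_component[OF that] by measurable
  have EF: "emeasure (pairs_space N) (F j) \<le> ennreal (2 * m * s)" if j: "j \<in> {2..N}" for j
  proof -
    have "emeasure (pairs_space N) (F j) =
        (\<integral>\<^sup>+a. emeasure (PiM {2..N} (\<lambda>_. std_normal_pair)) (Pair a -` F j) \<partial>std_normal_pair)"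
      by (rule R.emeasure_pair_measure_alt[OF F[OF j]])
    \<comment> \<open>The slice of \<open>F j\<close> at \<open>a\<close> constrains only coordinate
      \<open>j\<close>, whose marginal law is \<open>std_normal_pair\<close>.\<close>
    also have "\<dots> = (\<integral>\<^sup>+a. emeasure std_normal_pair {b. swap s a b \<noteq> 0} \<partial>std_normal_pair)"
    proof (rule nn_integral_cong)
      fix a
      have [measurable]: "swap s a \<in> borel_measurable (borel \<Otimes>\<^sub>M borel)"
        unfolding swap_def[abs_def] of_bool_def by measurable
      have "{b \<in> space std_normal_pair. swap s a b \<noteq> 0} \<in> sets std_normal_pair"
        by measurable
      then have "emeasure (distr (PiM {2..N} (\<lambda>_. std_normal_pair)) std_normal_pair (\<lambda>r. r j)) {b. swap s a b \<noteq> 0} =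
          emeasure (PiM {2..N} (\<lambda>_. std_normal_pair))
            ((\<lambda>r. r j) -` {b. swap s a b \<noteq> 0} \<inter> space (PiM {2..N} (\<lambda>_. std_normal_pair)))"
        using j by (intro emeasure_distr) auto
      also have "(\<lambda>r. r j) -` {b. swap s a b \<noteq> 0} \<inter> space (PiM {2..N} (\<lambda>_. std_normal_pair)) = Pair a -` F j"
        by (auto simp: F_def space_pair_measure)
      finally show "emeasure (PiM {2..N} (\<lambda>_. std_normal_pair)) (Pair a -` F j) =
          emeasure std_normal_pair {b. swap s a b \<noteq> 0}"
        using distr_PiM_component[of "{2..N}" "\<lambda>_. std_normal_pair" j] j
        by (simp add: prob_space_std_normal_pair)
    qed
    also have "\<dots> \<le> (\<integral>\<^sup>+a. (\<integral>\<^sup>+v. ennreal s * (ennreal \<bar>snd a\<bar> + ennreal \<bar>v\<bar>) \<partial>std_normal_distribution)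
        \<partial>std_normal_pair)"
      by (intro nn_integral_mono emeasure_swap_nonzero_le assms)
    also have "\<dots> = (\<integral>\<^sup>+a. ennreal s * (ennreal \<bar>snd a\<bar> + ennreal m) \<partial>std_normal_pair)"
      using G.emeasure_space_1 by (simp add: nn_integral_cmult nn_integral_add m)
    also have "\<dots> = (\<integral>\<^sup>+x. (\<integral>\<^sup>+z. ennreal s * (ennreal \<bar>z\<bar> + ennreal m) \<partial>std_normal_distribution)
        \<partial>std_normal_distribution)"
      by (subst G.nn_integral_fst[symmetric]) simp_all
    also have "\<dots> = ennreal s * (ennreal m + ennreal m)"
      using G.emeasure_space_1 by (simp add: nn_integral_cmult nn_integral_add m)
    also have "\<dots> = ennreal (2 * m * s)"
      using assms m0 by (simp add: ennreal_plus[symmetric] ennreal_mult'[symmetric] mult_ac del: ennreal_plus)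
    finally show ?thesis .
  qed
  have "{w \<in> space (pairs_space N). sum_swap N s w \<noteq> 0} \<subseteq> (\<Union>j\<in>{2..N}. F j)"
    by (auto simp: F_def sum_swap_def intro: ccontr[where P="Bex _ _"] dest: sum.not_neutral_contains_not_neutral)
  then have "measure (pairs_space N) {w \<in> space (pairs_space N). sum_swap N s w \<noteq> 0} \<le>
      measure (pairs_space N) (\<Union>j\<in>{2..N}. F j)"
    by (rule P.finite_measure_mono) measurable
  also have "\<dots> \<le> (\<Sum>j\<in>{2..N}. measure (pairs_space N) (F j))"
    using F by (intro P.finite_measure_subadditive_finite) blast+
  also have "\<dots> \<le> (\<Sum>j\<in>{2..N}. 2 * m * s)"
    using EF assms m0 by (intro sum_mono) (simp add: P.emeasure_eq_measure)
  also have "\<dots> = real (card {2..N}) * (2 * m * s)"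
    by simp
  also have "\<dots> \<le> real N * (2 * m * s)"
    using assms m0 by (intro mult_right_mono) auto
  finally show ?thesis
    by (simp add: m_def mult_ac)
qed

section \<open>Characteristic function of a single crossing\<close>

text \<open>Mass \<open>\<delta>\<close> of \<open>A\<close> is paired with mass
  \<open>\<delta>\<close> of \<open>C\<close>: together they contribute at most
  \<open>\<delta> * norm (1 + \<alpha>)\<close> instead of \<open>2 * \<delta>\<close>. The
  remaining mass is estimated trivially by \<open>norm (f x) \<le> 1\<close>.\<close>

lemma (in prob_space) norm_integral_two_values_le:
  fixes f :: "'a \<Rightarrow> complex"
  assumes f [measurable]: "f \<in> borel_measurable M" and f_le: "\<And>x. norm (f x) \<le> 1"
    and AC [measurable]: "A \<in> events" "C \<in> events" and disj: "A \<inter> C = {}"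
    and fA: "\<And>x. x \<in> A \<Longrightarrow> f x = \<alpha>" and fC: "\<And>x. x \<in> C \<Longrightarrow> f x = 1"
    and \<alpha>: "norm \<alpha> \<le> 1"
    and \<delta>: "0 \<le> \<delta>" "\<delta> \<le> prob A" "\<delta> \<le> prob C"
  shows "norm (\<integral>x. f x \<partial>M) \<le> 1 - \<delta> * (2 - norm (1 + \<alpha>))"
proof -
  define D where "D = space M - (A \<union> C)"
  have D [measurable]: "D \<in> events"
    by (simp add: D_def)
  have probD: "prob D = 1 - (prob A + prob C)"
    unfolding D_def using disj by (simp add: prob_compl finite_measure_Union)
  have bounded: "integrable M (\<lambda>x. indicat_real S x *\<^sub>R g x)"
    if "S \<in> events" "g \<in> borel_measurable M" "\<And>x. norm (g x) \<le> 1" for S and g :: "'a \<Rightarrow> complex"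
    using that by (intro integrable_const_bound[where B=1] AE_I2) (auto simp: indicator_def)
  have "(\<integral>x. f x \<partial>M) =
      (\<integral>x. indicat_real A x *\<^sub>R \<alpha> + indicat_real C x *\<^sub>R 1 + indicat_real D x *\<^sub>R f x \<partial>M)"
    by (intro Bochner_Integration.integral_cong)
      (use fA fC disj in \<open>auto simp: D_def indicator_def\<close>)
  also have "\<dots> = prob A *\<^sub>R \<alpha> + prob C *\<^sub>R 1 + (\<integral>x. indicat_real D x *\<^sub>R f x \<partial>M)"
  proof -
    have "(\<integral>x. indicat_real S x *\<^sub>R c \<partial>M) = prob S *\<^sub>R c" if "S \<in> events" for S and c :: complex
      using that by (subst integral_scaleR_left) (auto intro!: integrable_real_indicator simp: emeasure_eq_measure)
    then show ?thesis
      using \<alpha> f_le AC D by (simp add: bounded del: scaleR_one)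
  qed
  also have "\<dots> = (prob A - \<delta>) *\<^sub>R \<alpha> + (prob C - \<delta>) *\<^sub>R 1 + \<delta> *\<^sub>R (1 + \<alpha>) +
      (\<integral>x. indicat_real D x *\<^sub>R f x \<partial>M)"
    by (simp add: algebra_simps)
  also have "norm \<dots> \<le> (prob A - \<delta>) + (prob C - \<delta>) + \<delta> * norm (1 + \<alpha>) + prob D"
  proof (intro norm_triangle_mono)
    show "norm ((prob A - \<delta>) *\<^sub>R \<alpha>) \<le> prob A - \<delta>"
      using \<delta> \<alpha> by (simp add: mult_left_le)
    have "norm (\<integral>x. indicat_real D x *\<^sub>R f x \<partial>M) \<le> (\<integral>x. norm (indicat_real D x *\<^sub>R f x) \<partial>M)"
      by (rule integral_norm_bound)
    also have "\<dots> \<le> (\<integral>x. indicat_real D x \<partial>M)"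
      using f_le by (intro integral_mono integrable_norm[OF bounded[OF D f f_le]] integrable_real_indicator)
        (auto simp: indicator_def emeasure_eq_measure)
    finally show "norm (\<integral>x. indicat_real D x *\<^sub>R f x \<partial>M) \<le> prob D"
      by simp
  qed (use \<delta> in simp_all)
  also have "\<dots> = 1 - \<delta> * (2 - norm (1 + \<alpha>))"
    by (simp add: probD algebra_simps)
  finally show ?thesis .
qed

text \<open>Characteristic function at \<open>t\<close> of one crossing, conditional on the value
  \<open>a\<close> of (X_1, Z_1).\<close>

definition swap_char :: "real \<Rightarrow> real \<Rightarrow> real \<times> real \<Rightarrow> complex" where
  "swap_char s t a = (\<integral>b. cis (t * swap s a b) \<partial>std_normal_pair)"

lemma measurable_cis [measurable]: "cis \<in> borel_measurable borel"
  by (intro borel_measurable_continuous_onI continuous_intros)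

lemma measurable_swap_char [measurable]:
  "swap_char s t \<in> borel_measurable (borel \<Otimes>\<^sub>M borel)"
proof -
  interpret prob_space std_normal_pair
    by (rule prob_space_std_normal_pair)
  have "(\<lambda>(a, b). cis (t * swap s a b)) \<in>
      borel_measurable ((borel \<Otimes>\<^sub>M borel) \<Otimes>\<^sub>M std_normal_pair)"
    by measurable
  then show ?thesis
    unfolding swap_char_def[abs_def] by (rule borel_measurable_lebesgue_integral)
qed

text \<open>
  The densities bound from below the probabilities of the boxes \<open>A\<close> (value \<open>1\<close>) and \<open>C\<close> (value \<open>0\<close>) in
  the next proof.
\<close>

definition swap_rate :: "real \<times> real \<Rightarrow> real" where
  "swap_rate a = std_normal_density (\<bar>fst a\<bar> + 1) *
     min (std_normal_density (\<bar>snd a - 2\<bar> + 1)) (std_normal_density (\<bar>snd a\<bar> + 1))"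

lemma swap_rate_pos: "0 < swap_rate a"
  by (simp add: swap_rate_def normal_density_pos)

text \<open>The crossing takes the values 1 and 0 with probability at least
  \<open>min 1 s * swap_rate a\<close> each, so \<open>norm_integral_two_values_le\<close> applies.
  The bound separates \<open>s\<close>, \<open>a\<close> and \<open>t\<close>, which allows a limit
  in \<open>s\<close> for fixed \<open>a\<close> and \<open>t\<close>.\<close>

lemma norm_swap_char_le:
  assumes s: "0 < s"
  shows "norm (swap_char s t a) \<le> 1 - min 1 s * swap_rate a * (2 - norm (1 + cis t))"
proof -
  interpret G: prob_space std_normal_distribution
    by (rule prob_space_std_normal)
  interpret prob_space std_normal_pair
    by (rule prob_space_std_normal_pair)
  obtain x z where a: "a = (x, z)"
    by (cases a)
  \<comment> \<open>The width must be at most 1 for the density bound and at most \<open>s\<close>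
    for the noise to undo the lead on \<open>A\<close>.\<close>
  define h where "h = min 1 s"
  \<comment> \<open>On \<open>A\<close> the lead of \<open>fst b\<close> over \<open>x\<close> is at
    most \<open>h \<le> s\<close>, while \<open>snd b \<le> z - 1\<close> costs at least
    \<open>s\<close>: the lead is lost.\<close>
  define A where "A = {x<..x + h} \<times> {z - 2<..z - 2 + 1}"
  \<comment> \<open>On \<open>C\<close> both components exceed those of \<open>a\<close>, so the
    order survives the noise.\<close>
  define C where "C = {x<..x + 1} \<times> {z<..z + 1}"
  have h: "0 < h" "h \<le> 1" "h \<le> s"
    using s by (auto simp: h_def)
  have prob_Times: "prob (U \<times> V) = G.prob U * G.prob V" if "U \<in> sets borel" "V \<in> sets borel" for U V
    using G.emeasure_pair_measure_Times[of U std_normal_distribution V] that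
    by (simp add: emeasure_eq_measure G.emeasure_eq_measure ennreal_mult[symmetric])
  have [measurable]: "swap s a \<in> borel_measurable (borel \<Otimes>\<^sub>M borel)"
    unfolding swap_def[abs_def] of_bool_def by measurable
  have A_ge: "h * swap_rate a \<le> prob A"
  proof -
    have "h * swap_rate a \<le> (h * std_normal_density (\<bar>x\<bar> + 1)) * (1 * std_normal_density (\<bar>z - 2\<bar> + 1))"
      using h by (simp add: swap_rate_def a mult.assoc mult_left_mono)
    also have "\<dots> \<le> G.prob {x<..x + h} * G.prob {z - 2<..z - 2 + 1}"
      using h by (intro mult_mono measure_std_normal_ge) auto
    also have "\<dots> = prob A"
      unfolding A_def by (rule prob_Times[symmetric]) auto
    finally show ?thesis .
  qed
  have C_ge: "h * swap_rate a \<le> prob C"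
  proof -
    \<comment> \<open>The width of \<open>C\<close> does not shrink with \<open>s\<close>; the
      factor \<open>h\<close> is given away to have one \<open>\<delta>\<close> for both
      boxes.\<close>
    have "h * swap_rate a \<le> 1 * swap_rate a"
      using h swap_rate_pos[of a] by (intro mult_right_mono) auto
    also have "\<dots> \<le> (1 * std_normal_density (\<bar>x\<bar> + 1)) * (1 * std_normal_density (\<bar>z\<bar> + 1))"
      by (simp add: swap_rate_def a mult_left_mono)
    also have "\<dots> \<le> G.prob {x<..x + 1} * G.prob {z<..z + 1}"
      by (intro mult_mono measure_std_normal_ge) auto
    also have "\<dots> = prob C"
      unfolding C_def by (rule prob_Times[symmetric]) auto
    finally show ?thesis .
  qed
  have swap_A: "swap s a b = 1" if "b \<in> A" for b
  proof -
    have b: "x < fst b" "fst b \<le> x + s" "snd b \<le> z - 1"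
      using that h by (auto simp: A_def)
    have "s * snd b \<le> s * (z - 1)"
      using b s by simp
    then have "fst b + s * snd b \<le> x + s * z"
      using b by (simp add: algebra_simps)
    then show ?thesis
      using b by (simp add: swap_def a)
  qed
  have swap_C: "swap s a b = 0" if "b \<in> C" for b
  proof -
    have b: "x < fst b" "z < snd b"
      using that by (auto simp: C_def)
    then have "x + s * z < fst b + s * snd b"
      using s by (intro add_strict_mono) auto
    then show ?thesis
      using b by (simp add: swap_def a)
  qed
  have "norm (swap_char s t a) \<le> 1 - h * swap_rate a * (2 - norm (1 + cis t))"
    unfolding swap_char_def
  proof (rule norm_integral_two_values_le[where A=A and C=C])
    show "(\<lambda>b. cis (t * swap s a b)) \<in> borel_measurable std_normal_pair"
      by measurable
    show "A \<in> events" "C \<in> events"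
      unfolding A_def C_def by (auto intro!: pair_measureI)
    show "A \<inter> C = {}"
      by (auto simp: A_def C_def)
    show "0 \<le> h * swap_rate a"
      using h swap_rate_pos[of a] by simp
  qed (use A_ge C_ge swap_A swap_C in auto)
  then show ?thesis
    by (simp add: h_def)
qed

section \<open>From characteristic functions to the probability of a zero sum\<close>

lemma cis_sum: "cis (sum f A) = (\<Prod>x\<in>A. cis (f x))"
  by (induction A rule: infinite_finite_induct) (simp_all add: cis_mult[symmetric])

text \<open>By Fubini the first pair is fixed at \<open>a\<close>; the other N - 1 pairs are then
  i.i.d., and the expectation of the product is a power of \<open>swap_char s t a\<close>.\<close>

lemma integral_cis_sum_swap:
  "(\<integral>w. cis (t * sum_swap N s w) \<partial>pairs_space N) =
    (\<integral>a. swap_char s t a ^ (N - 1) \<partial>std_normal_pair)"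
proof -
  interpret P: prob_space "pairs_space N"
    by (rule prob_space_pairs_space)
  interpret G: prob_space std_normal_pair
    by (rule prob_space_std_normal_pair)
  interpret R: prob_space "PiM {2..N} (\<lambda>_. std_normal_pair)"
    by (rule prob_space_PiM_std_normal_pair)
  interpret product_sigma_finite "\<lambda>_::nat. std_normal_pair"
    by unfold_locales
  interpret pair_sigma_finite std_normal_pair "PiM {2..N} (\<lambda>_. std_normal_pair)" ..
  have "(\<lambda>w. cis (t * sum_swap N s w)) \<in> borel_measurable (pairs_space N)"
    by measurable
  then have "integrable (pairs_space N) (\<lambda>w. cis (t * sum_swap N s w))"
    by (intro P.integrable_const_bound[where B=1]) auto
  then have "(\<integral>w. cis (t * sum_swap N s w) \<partial>pairs_space N) =
      (\<integral>a. (\<integral>r. cis (t * sum_swap N s (a, r)) \<partial>PiM {2..N} (\<lambda>_. std_normal_pair)) \<partial>std_normal_pair)"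
    by (rule integral_fst'[symmetric])
  also have "\<dots> = (\<integral>a. swap_char s t a ^ (N - 1) \<partial>std_normal_pair)"
  proof (rule Bochner_Integration.integral_cong)
    fix a
    have [measurable]: "swap s a \<in> borel_measurable (borel \<Otimes>\<^sub>M borel)"
      unfolding swap_def[abs_def] of_bool_def by measurable
    have "(\<lambda>b. cis (t * swap s a b)) \<in> borel_measurable std_normal_pair"
      by measurable
    then have int: "integrable std_normal_pair (\<lambda>b. cis (t * swap s a b))"
      by (intro G.integrable_const_bound[where B=1]) auto
    have "cis (t * sum_swap N s (a, r)) = (\<Prod>j\<in>{2..N}. cis (t * swap s a (r j)))" for r
      by (simp add: sum_swap_def sum_distrib_left cis_sum)
    then show "(\<integral>r. cis (t * sum_swap N s (a, r)) \<partial>PiM {2..N} (\<lambda>_. std_normal_pair)) =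
        swap_char s t a ^ (N - 1)"
      using product_integral_prod[of "{2..N}" "\<lambda>_ b. cis (t * swap s a b)"] int
      by (simp add: swap_char_def)
  qed simp
  finally show ?thesis .
qed

lemma sum_swap_Ints: "sum_swap N s w \<in> \<int>"
  unfolding sum_swap_def swap_def of_bool_def by (intro Ints_sum) auto

text \<open>For an integer k, the average over l < m of exp(2 pi i l k / m) is 1 if m divides k and
  0 otherwise. It therefore dominates the indicator of k = 0, for any choice of
  \<open>m\<close>.\<close>

lemma measure_sum_swap_zero_le:
  assumes m: "0 < m"
  shows "measure (pairs_space N) {w \<in> space (pairs_space N). sum_swap N s w = 0} \<le>
    (\<Sum>l<m. norm (\<integral>w. cis (2 * pi * real l / real m * sum_swap N s w) \<partial>pairs_space N)) / real m"
proof -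
  interpret P: prob_space "pairs_space N"
    by (rule prob_space_pairs_space)
  define e where "e l w = cis (2 * pi * real l / real m * sum_swap N s w)" for l :: nat and w
  have e: "integrable (pairs_space N) (e l)" for l
    unfolding e_def by (intro P.integrable_const_bound[where B=1]) auto
  have ge: "real m * indicator {0} (sum_swap N s w) \<le> (\<Sum>l<m. Re (e l w))" for w
  proof -
    define \<zeta> where "\<zeta> = cis (2 * pi / real m * sum_swap N s w)"
    have e_pow: "e l w = \<zeta> ^ l" for l
      by (simp add: e_def \<zeta>_def Complex.DeMoivre mult_ac)
    obtain k where k: "sum_swap N s w = of_int k"
      by (rule Ints_cases[OF sum_swap_Ints])
    have \<zeta>m: "\<zeta> ^ m = 1"
      using m by (simp add: \<zeta>_def Complex.DeMoivre k cis_multiple_2pi)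
    \<comment> \<open>A geometric sum, which vanishes for \<open>\<zeta> \<noteq> 1\<close> because
      \<open>\<zeta> ^ m = 1\<close>.\<close>
    have "(\<Sum>l<m. e l w) = (if \<zeta> = 1 then of_nat m else 0)"
      by (simp add: e_pow sum_gp_strict \<zeta>m)
    then have "(\<Sum>l<m. Re (e l w)) = (if \<zeta> = 1 then real m else 0)"
      by (simp flip: Re_sum)
    then show ?thesis
      by (auto simp: indicator_def \<zeta>_def)
  qed
  have "real m * measure (pairs_space N) {w \<in> space (pairs_space N). sum_swap N s w = 0} =
      (\<integral>w. real m * indicator {0} (sum_swap N s w) \<partial>pairs_space N)"
  proof -
    let ?S = "{w \<in> space (pairs_space N). sum_swap N s w = 0}"
    have "(\<integral>w. indicat_real {0} (sum_swap N s w) \<partial>pairs_space N) =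
        (\<integral>w. indicat_real ?S w \<partial>pairs_space N)"
      by (intro Bochner_Integration.integral_cong) (auto simp: indicator_def)
    moreover have "?S \<inter> space (pairs_space N) = ?S"
      by blast
    ultimately show ?thesis
      by simp
  qed
  also have "\<dots> \<le> (\<integral>w. (\<Sum>l<m. Re (e l w)) \<partial>pairs_space N)"
  proof (rule integral_mono[OF _ _ ge])
    show "integrable (pairs_space N) (\<lambda>w. real m * indicator {0} (sum_swap N s w))"
      by (intro integrable_mult_right P.integrable_const_bound[where B=1]) auto
    show "integrable (pairs_space N) (\<lambda>w. \<Sum>l<m. Re (e l w))"
      using e by (intro Bochner_Integration.integrable_sum integrable_Re)
  qed
  also have "\<dots> = (\<Sum>l<m. Re (\<integral>w. e l w \<partial>pairs_space N))"
    using e by (simp add: Bochner_Integration.integral_sum integrable_Re)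
  also have "\<dots> \<le> (\<Sum>l<m. norm (\<integral>w. e l w \<partial>pairs_space N))"
    by (intro sum_mono complex_Re_le_cmod)
  finally show ?thesis
    using m by (simp add: e_def field_simps)
qed

text \<open>The squared norm is \<open>2 + 2 * cos t\<close>. This makes the gap
  \<open>2 - norm (1 + cis t)\<close> in \<open>norm_swap_char_le\<close> positive.\<close>

lemma norm_one_plus_cis_less:
  assumes "cis t \<noteq> 1"
  shows "norm (1 + cis t) < 2"
proof -
  have "cos t \<noteq> 1"
  proof
    assume "cos t = 1"
    moreover from this have "sin t = 0"
      using sin_cos_squared_add[of t] by simp
    ultimately show False
      using assms by (simp add: complex_eq_iff)
  qed
  then have "cos t < 1"
    using cos_le_one[of t] by linarith
  moreover have "(norm (1 + cis t))\<^sup>2 = 2 + 2 * cos t"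
    using sin_cos_squared_add[of t] by (simp add: cmod_power2 power2_sum)
  ultimately have "(norm (1 + cis t))\<^sup>2 < 2\<^sup>2"
    by simp
  then show ?thesis
    by (rule power_less_imp_less_base) simp
qed

section \<open>Vanishing of the probability for large noise\<close>

text \<open>For fixed \<open>a\<close>, the inequality 1 + x \<le> exp x turns the power into an
  exponential with exponent tending to minus infinity. The rate is not uniform, since
  \<open>swap_rate a\<close> is not bounded away from 0, so the integral is handled by dominated
  convergence with bound 1.\<close>

lemma integral_cis_sum_swap_tendsto_0:
  assumes s: "\<And>N. 1 \<le> N \<Longrightarrow> 0 < s N"
    and sN: "filterlim (\<lambda>N. real (N - 1) * min 1 (s N)) at_top sequentially"
    and t: "cis t \<noteq> 1"
  shows "(\<lambda>N. \<integral>w. cis (t * sum_swap N (s N) w) \<partial>pairs_space N) \<longlonglongrightarrow> 0"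
proof -
  interpret prob_space std_normal_pair
    by (rule prob_space_std_normal_pair)
  define \<epsilon> where "\<epsilon> = 2 - norm (1 + cis t)"
  have \<epsilon>: "0 < \<epsilon>"
    using norm_one_plus_cis_less[OF t] by (simp add: \<epsilon>_def)
  have le1: "norm (swap_char r t a) \<le> 1" if "0 < r" for r a
  proof -
    have "0 \<le> min 1 r * swap_rate a * \<epsilon>"
      using that \<epsilon> swap_rate_pos[of a] by simp
    then show ?thesis
      using norm_swap_char_le[OF that, of t a] by (simp add: \<epsilon>_def)
  qed
  have lim: "(\<lambda>N. swap_char (s N) t a ^ (N - 1)) \<longlonglongrightarrow> 0" for a
  proof (rule Lim_null_comparison)
    define c where "c = swap_rate a * \<epsilon>"
    have c: "0 < c"
      using \<epsilon> swap_rate_pos[of a] by (simp add: c_def)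
    show "\<forall>\<^sub>F N in sequentially. norm (swap_char (s N) t a ^ (N - 1)) \<le>
        exp (- (c * (real (N - 1) * min 1 (s N))))"
      using eventually_ge_at_top[of 1]
    proof eventually_elim
      case (elim N)
      have "norm (swap_char (s N) t a) \<le> 1 + - (c * min 1 (s N))"
        using norm_swap_char_le[OF s[OF elim], of t a] by (simp add: c_def \<epsilon>_def mult_ac)
      also have "\<dots> \<le> exp (- (c * min 1 (s N)))"
        by (rule exp_ge_add_one_self)
      finally have "norm (swap_char (s N) t a) ^ (N - 1) \<le> exp (- (c * min 1 (s N))) ^ (N - 1)"
        by (rule power_mono) simp
      then show ?case
        by (simp add: norm_power exp_of_nat_mult[symmetric] mult_ac)
    qed
    show "(\<lambda>N. exp (- (c * (real (N - 1) * min 1 (s N))))) \<longlonglongrightarrow> 0"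
      by (intro filterlim_compose[OF exp_at_bot] filterlim_compose[OF filterlim_uminus_at_bot_at_top]
          filterlim_tendsto_pos_mult_at_top[OF tendsto_const c sN])
  qed
  \<comment> \<open>The sequence is shifted by one because the domination must hold at every index,
    and \<open>s\<close> is known to be positive only from 1 on.\<close>
  have "(\<lambda>N. \<integral>a. swap_char (s (Suc N)) t a ^ (Suc N - 1) \<partial>std_normal_pair) \<longlonglongrightarrow>
      (\<integral>a. 0 \<partial>std_normal_pair)"
  proof (rule integral_dominated_convergence[where w="\<lambda>_. 1"])
    show "AE a in std_normal_pair. (\<lambda>N. swap_char (s (Suc N)) t a ^ (Suc N - 1)) \<longlonglongrightarrow> 0"
      by (rule AE_I2) (rule LIMSEQ_Suc[OF lim])
    show "AE a in std_normal_pair. norm (swap_char (s (Suc N)) t a ^ (Suc N - 1)) \<le> 1" for N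
      by (rule AE_I2) (simp add: norm_power power_le_one le1 s)
  qed auto
  then have "(\<lambda>N. \<integral>w. cis (t * sum_swap (Suc N) (s (Suc N)) w) \<partial>pairs_space (Suc N)) \<longlonglongrightarrow> 0"
    by (simp only: integral_cis_sum_swap integral_zero)
  then show ?thesis
    by (rule LIMSEQ_imp_Suc)
qed

text \<open>First \<open>m\<close> is fixed with 1 / m below r / 2, which absorbs the root 1
  (\<open>l = 0\<close>); then the finitely many other roots contribute less than r / 2 for large
  \<open>N\<close>.\<close>

lemma measure_sum_swap_zero_tendsto_0:
  assumes s: "\<And>N. 1 \<le> N \<Longrightarrow> 0 < s N"
    and sN: "filterlim (\<lambda>N. real (N - 1) * min 1 (s N)) at_top sequentially"
  shows "(\<lambda>N. measure (pairs_space N) {w \<in> space (pairs_space N). sum_swap N (s N) w = 0}) \<longlonglongrightarrow> 0"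
proof (rule LIMSEQ_I)
  fix r :: real
  assume r: "0 < r"
  obtain n where "inverse (real (Suc n)) < r / 2"
    using reals_Archimedean[of "r / 2"] r by auto
  then obtain m :: nat where m: "0 < m" "1 / real m < r / 2"
    by (metis inverse_eq_divide zero_less_Suc)
  define E where "E l N = norm (\<integral>w. cis (2 * pi * real l / real m * sum_swap N (s N) w) \<partial>pairs_space N)"
    for l N
  have E0: "E 0 N = 1" for N
    using prob_space.prob_space[OF prob_space_pairs_space[of N]] by (simp add: E_def)
  have E: "E l \<longlonglongrightarrow> 0" if l: "l \<in> {1..<m}" for l
  proof -
    \<comment> \<open>Otherwise \<open>m\<close> would divide \<open>l\<close>, which is impossible
      for 0 < l < m.\<close>
    have "cis (2 * pi * real l / real m) \<noteq> 1"
    proof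
      assume "cis (2 * pi * real l / real m) = 1"
      then have "cos (2 * pi * real l / real m) = 1"
        by (simp add: complex_eq_iff)
      then obtain k :: int where "2 * pi * real l / real m = of_int k * 2 * pi"
        by (auto simp: cos_one_2pi_int)
      then have "real l = of_int k * real m"
        using m by (simp add: field_simps)
      then have "int l = k * int m"
        by (metis of_int_eq_iff of_int_mult of_int_of_nat_eq)
      then show False
        using l by (metis atLeastLessThan_iff dvd_triv_right int_dvd_int_iff nat_dvd_not_less zero_less_one order_less_le_trans)
    qed
    then show ?thesis
      using tendsto_norm_zero[OF integral_cis_sum_swap_tendsto_0[OF s sN]] unfolding E_def by blast
  qed
  have "(\<lambda>N. \<Sum>l\<in>{1..<m}. E l N) \<longlonglongrightarrow> (\<Sum>l\<in>{1..<m}. 0)"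
    by (intro tendsto_sum E)
  then have "\<forall>\<^sub>F N in sequentially. (\<Sum>l\<in>{1..<m}. E l N) < r / 2"
    using r by (intro order_tendstoD(2)) auto
  then have "\<forall>\<^sub>F N in sequentially.
      norm (measure (pairs_space N) {w \<in> space (pairs_space N). sum_swap N (s N) w = 0} - 0) < r"
  proof eventually_elim
    case (elim N)
    have "{..<m} = insert 0 {1..<m}"
      using m by auto
    then have "(\<Sum>l<m. E l N) = 1 + (\<Sum>l\<in>{1..<m}. E l N)"
      by (simp add: E0)
    then have "measure (pairs_space N) {w \<in> space (pairs_space N). sum_swap N (s N) w = 0} \<le>
        1 / real m + (\<Sum>l\<in>{1..<m}. E l N) / real m"
      using measure_sum_swap_zero_le[OF m(1), of N "s N"] by (simp add: E_def add_divide_distrib)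
    also have "(\<Sum>l\<in>{1..<m}. E l N) / real m \<le> (\<Sum>l\<in>{1..<m}. E l N)"
    proof -
      have "0 \<le> (\<Sum>l\<in>{1..<m}. E l N)"
        unfolding E_def by (intro sum_nonneg) simp
      then show ?thesis
        using m mult_left_mono[of 1 "real m" "\<Sum>l\<in>{1..<m}. E l N"] by (simp add: divide_le_eq)
    qed
    finally show ?case
      using m elim by simp
  qed
  then show "\<exists>N0. \<forall>N\<ge>N0.
      norm (measure (pairs_space N) {w \<in> space (pairs_space N). sum_swap N (s N) w = 0} - 0) < r"
    by (simp add: eventually_sequentially)
qed

section \<open>The two regimes of the noise level\<close>

theorem proposition2p2:
  fixes s :: "nat \<Rightarrow> real"
    and M :: "nat \<Rightarrow> 'a measure"
    and X Z Y :: "nat \<Rightarrow> 'a \<Rightarrow> nat \<Rightarrow> real"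
    and p :: "nat \<Rightarrow> real"
  assumes "\<And>N. N \<ge> 1 \<Longrightarrow> s N > 0"
    and "\<And>N. N \<ge> 1 \<Longrightarrow> prob_space (M N)"
    and "\<And>N. N \<ge> 1 \<Longrightarrow> std_gaussian_vector (M N) N (X N)"
    and "\<And>N. N \<ge> 1 \<Longrightarrow> std_gaussian_vector (M N) N (Z N)"
    and "\<And>N. N \<ge> 1 \<Longrightarrow> indep_vectors (M N) N (X N) (Z N)"
  defines "Y \<equiv> \<lambda>N \<omega> i. X N \<omega> i + s N * Z N \<omega> i"
    and "p \<equiv> \<lambda>N. prob_same_rank (M N) N (X N) (Y N)"
  shows "(s \<in> o(\<lambda>N. 1 / real N) \<longrightarrow> p \<longlonglongrightarrow> 1) \<and>
         (s \<in> \<omega>(\<lambda>N. 1 / real N) \<longrightarrow> p \<longlonglongrightarrow> 0)"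
proof -
  define q where "q N = measure (pairs_space N) {w \<in> space (pairs_space N). sum_swap N (s N) w = 0}" for N
  have "p N = q N" if "1 \<le> N" for N
    unfolding p_def Y_def q_def by (intro prob_same_rank_eq assms that)
  \<comment> \<open>Equality from N = 1 on is enough for the limits.\<close>
  then have p_eq: "\<forall>\<^sub>F N in sequentially. p N = q N"
    by (intro eventually_sequentiallyI)
  have "q \<longlonglongrightarrow> 1" if o: "s \<in> o(\<lambda>N. 1 / real N)"
  proof -
    define m where "m = (\<integral>v. \<bar>v\<bar> \<partial>std_normal_distribution)"
    have "(\<lambda>N. s N / (1 / real N)) \<longlonglongrightarrow> 0"
      by (rule smalloD_tendsto[OF o])
    \<comment> \<open>This also holds at N = 0, where division by zero makes both expressions
      0.\<close>
    then have "(\<lambda>N. real N * s N) \<longlonglongrightarrow> 0"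
      by (simp add: mult.commute)
    then have lim: "(\<lambda>N. 1 - 2 * m * (real N * s N)) \<longlonglongrightarrow> 1"
      using tendsto_diff[OF tendsto_const tendsto_mult_left, of "\<lambda>N. real N * s N" 0 sequentially 1 "2 * m"] by simp
    have lower: "1 - 2 * m * (real N * s N) \<le> q N" if N: "1 \<le> N" for N
    proof -
      interpret P: prob_space "pairs_space N"
        by (rule prob_space_pairs_space)
      have "{w \<in> space (pairs_space N). sum_swap N (s N) w = 0} \<in> P.events"
        by measurable
      from P.prob_neg[OF this] have "1 - q N = measure (pairs_space N) {w \<in> space (pairs_space N). sum_swap N (s N) w \<noteq> 0}"
        by (simp only: q_def)
      then show ?thesis
        using measure_sum_swap_nonzero_le[of "s N" N] assms(1)[OF N] by (simp add: m_def)
    qed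
    show ?thesis
    proof (rule tendsto_sandwich[OF _ _ lim tendsto_const])
      show "\<forall>\<^sub>F N in sequentially. 1 - 2 * m * (real N * s N) \<le> q N"
        using lower by (rule eventually_sequentiallyI)
      show "\<forall>\<^sub>F N in sequentially. q N \<le> 1"
        unfolding q_def by (intro always_eventually allI prob_space.prob_le_1 prob_space_pairs_space)
    qed
  qed
  moreover have "q \<longlonglongrightarrow> 0" if w: "s \<in> \<omega>(\<lambda>N. 1 / real N)"
    unfolding q_def
  proof (rule measure_sum_swap_zero_tendsto_0[OF assms(1)])
    show "filterlim (\<lambda>N. real (N - 1) * min 1 (s N)) at_top sequentially"
      unfolding filterlim_at_top
    proof
      fix K :: real
      \<comment> \<open>The factor 2 pays for replacing N by N - 1, as N \<le> 2 (N - 1) for N \<ge>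
        2; the maximum with 1 keeps \<open>c\<close> positive.\<close>
      define c where "c = max 1 (2 * K)"
      have c: "0 < c" "2 * K \<le> c"
        by (auto simp: c_def)
      have "\<forall>\<^sub>F N in sequentially. c * norm (1 / real N) \<le> norm (s N)"
        by (rule landau_omega.smallD[OF w c(1)])
      then show "\<forall>\<^sub>F N in sequentially. K \<le> real (N - 1) * min 1 (s N)"
        \<comment> \<open>This start gives both N \<ge> 2 and K \<le> N - 1; the latter settles the
          case where the minimum is 1.\<close>
        using eventually_ge_at_top[of "2 + nat \<lceil>K\<rceil>"]
      proof eventually_elim
        case (elim N)
        then have N: "2 \<le> N" "K \<le> real (N - 1)"
          by linarith+
        then have "c \<le> real N * s N"
          using elim(1) assms(1)[of N] by (simp add: field_simps)
        also have "\<dots> \<le> (2 * real (N - 1)) * s N"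
          using N assms(1)[of N] by (intro mult_right_mono) auto
        finally have "K \<le> real (N - 1) * s N"
          using c by linarith
        then show ?case
          using N by (simp add: min_def)
      qed
    qed
  qed auto
  ultimately show ?thesis
    using tendsto_cong[OF p_eq] by blast
qed

end
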